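(* Let $F_\lambda$ be a Ferrers shape and let $\widetilde{F_\lambda}$ be an arbitrary shape obtained from $F_\lambda$ by permuting its columns. Then $\widetilde{F_\lambda}$ and $F_\lambda$ have the same number of $\Gamma$-free $0$-$1$ fillings.
   Context: Given a partition $\lambda=(\lambda_1\ge\lambda_2\ge\dots\ge\lambda_n\geq 1)$, the Ferrers shape $F_\lambda$ is the arrangement of cells justified to the left and to the bottom with $n$ rows, where the $i$-th row from the bottom has $\lambda_i$ cells. Permuting the columns means rearranging the (bottom-justified) columns of cells in an arbitrary order; the result is a set of cells in the grid in which the columns are still bottom-justified, but rows need not consist of contiguous cells. A $0$-$1$ filling of a shape assigns $0$ or $1$ to each of its cells. A filling is $\Gamma$-free if there are no three cells of the shape, all containing $1$, such that two of them are in the same row and the third lies in the same column as the left one of these two, strictly below it (rows and columns involved need not be adjacent). *)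

theory Defs
  imports "HOL-Combinatorics.Permutations" "HOL-Library.FuncSet"
begin

text \<open>
  A cell is a pair (row, column). Rows are numbered from the bottom and columns from the
  left, both starting at 0; a shape is a set of cells.
\<close>

type_synonym cell = "nat \<times> nat"

definition is_partition :: "nat list \<Rightarrow> bool" where
  "is_partition lam \<longleftrightarrow> sorted_wrt (\<ge>) lam \<and> (\<forall>k\<in>set lam. k \<ge> 1)"

definition ferrers_shape :: "nat list \<Rightarrow> cell set" where
  "ferrers_shape lam = {(i, j). i < length lam \<and> j < lam ! i}"

definition columns :: "cell set \<Rightarrow> nat set" where
  "columns S = snd ` S"

text \<open>
  Each column moves as a whole and every cell keeps its row, so the columns of a permuted
  Ferrers shape remain bottom-justified.
\<close>

definition column_permuted :: "cell set \<Rightarrow> cell set \<Rightarrow> bool" where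
  "column_permuted S T \<longleftrightarrow>
     (\<exists>p. p permutes columns S \<and> T = (\<lambda>(i, j). (i, p j)) ` S)"

text \<open>
  The extensional function space makes a filling determined by its values on the cells of
  the shape, so that fillings can be counted by cardinality.
\<close>

definition fillings :: "cell set \<Rightarrow> (cell \<Rightarrow> nat) set" where
  "fillings S = S \<rightarrow>\<^sub>E {0, 1}"

definition gamma_free :: "cell set \<Rightarrow> (cell \<Rightarrow> nat) \<Rightarrow> bool" where
  "gamma_free S f \<longleftrightarrow>
     \<not> (\<exists>r r' c c'. r' < r \<and> c < c' \<and>
          (r, c) \<in> S \<and> (r, c') \<in> S \<and> (r', c) \<in> S \<and>
          f (r, c) = 1 \<and> f (r, c') = 1 \<and> f (r', c) = 1)"

definition gamma_free_fillings :: "cell set \<Rightarrow> (cell \<Rightarrow> nat) set" where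
  "gamma_free_fillings S = {f \<in> fillings S. gamma_free S f}"

end

theory Submission
  imports Defs
begin

text \<open>
  A filling is read column by column, each column being the set of rows in which it holds a 1.
  An entry 1 that has another 1 below it in its column forbids all ones to the right of it in
  its row: it closes that row. A filling is \<open>\<Gamma>\<close>-free iff no column uses a row that a column to
  its left has closed. Filling the columns from left to right, the only thing to remember is
  therefore the set of rows that are still open, and a column of height \<open>h\<close> acts on functions of
  this set by the operator \<open>add_column h\<close>. The number of \<open>\<Gamma>\<close>-free fillings is the product of
  these operators, over the columns, applied to the constant 1, at the set of all rows.

  So the theorem follows once two such operators commute (\<open>add_column_commute\<close>). That is a
  statement about two neighbouring columns of heights \<open>h \<le> h'\<close>, holding the sets \<open>A\<close> and \<open>B\<close>. If
  their contents are compatible in both orders, the columns just change places. Otherwise they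
  also exchange the parts of their contents that lie below row \<open>h\<close>, so that in the picture only
  the part of the taller column from row \<open>h\<close> upwards moves. In this second case the two columns share
  exactly one row, the lowest entry of one of them and a non-lowest entry of the other, and this
  makes the exchange preserve the set of rows closed by the two columns together
  (\<open>closed_rows_swap_below\<close>).
\<close>

section \<open>Open and closed rows\<close>

definition closed_rows :: "nat set \<Rightarrow> nat set" where
  "closed_rows A = {r \<in> A. \<exists>r'\<in>A. r' < r}"

definition add_column :: "nat \<Rightarrow> (nat set \<Rightarrow> nat) \<Rightarrow> nat set \<Rightarrow> nat" where
  "add_column h F U = (\<Sum>A\<in>Pow (U \<inter> {..<h}). F (U - closed_rows A))"

section \<open>Exchanging two neighbouring columns\<close>

text \<open>
  Contents of a column of height \<open>h\<close> followed by one of height \<open>k\<close>. The second set is bounded by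
  \<open>U\<close> instead of \<open>U - closed_rows A\<close>, so that the order of the two columns matters for the last
  condition only.
\<close>

definition column_pairs :: "nat set \<Rightarrow> nat \<Rightarrow> nat \<Rightarrow> (nat set \<times> nat set) set" where
  "column_pairs U h k =
     {(A, B). A \<subseteq> U \<inter> {..<h} \<and> B \<subseteq> U \<inter> {..<k} \<and> closed_rows A \<inter> B = {}}"

lemma finite_column_pairs: "finite (column_pairs U h k)"
proof (rule finite_subset)
  show "column_pairs U h k \<subseteq> Pow {..<h} \<times> Pow {..<k}"
    by (auto simp: column_pairs_def)
qed simp

lemma add_column_twice:
  "add_column h (add_column k F) U =
     (\<Sum>(A, B)\<in>column_pairs U h k. F (U - (closed_rows A \<union> closed_rows B)))"
proof -
  have "column_pairs U h k =
      (SIGMA A:Pow (U \<inter> {..<h}). Pow ((U - closed_rows A) \<inter> {..<k}))"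
    by (auto simp: column_pairs_def)
  then show ?thesis
    by (simp add: add_column_def sum.Sigma Diff_eq Int_assoc)
qed

definition swap_below :: "nat \<Rightarrow> nat set \<times> nat set \<Rightarrow> nat set \<times> nat set" where
  "swap_below h = (\<lambda>(A, B). (B \<inter> {..<h}, A \<inter> {..<h} \<union> (B - {..<h})))"

lemma swap_below_swap_below:
  assumes "A \<subseteq> {..<h}"
  shows "swap_below h (swap_below h (A, B)) = (A, B)"
  using assms by (auto simp: swap_below_def)

definition only_before :: "nat set \<Rightarrow> nat set \<Rightarrow> bool" where
  "only_before A B \<longleftrightarrow> closed_rows A \<inter> B = {} \<and> closed_rows B \<inter> A \<noteq> {}"

text \<open>
  A row of \<open>A\<close> that \<open>B\<close> closes is a shared row, which \<open>A\<close> may not close. But \<open>A\<close> can leave open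
  its lowest row only.
\<close>

lemma only_before_iff:
  "only_before A B \<longleftrightarrow> (\<exists>x. A \<inter> B = {x} \<and> (\<forall>y\<in>A. x \<le> y) \<and> (\<exists>y\<in>B. y < x))"
proof
  assume *: "only_before A B"
  then obtain x where x: "x \<in> A" "x \<in> closed_rows B"
    by (auto simp: only_before_def)
  have open_A: "x' \<le> y" if "x' \<in> A" "x' \<in> B" "y \<in> A" for x' y
    using * that by (force simp: only_before_def closed_rows_def)
  have "x \<in> B" "\<exists>y\<in>B. y < x"
    using x by (auto simp: closed_rows_def)
  moreover from this x open_A have "A \<inter> B = {x}"
    by (auto intro: antisym)
  ultimately show "\<exists>x. A \<inter> B = {x} \<and> (\<forall>y\<in>A. x \<le> y) \<and> (\<exists>y\<in>B. y < x)"
    using x open_A by blast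
next
  assume "\<exists>x. A \<inter> B = {x} \<and> (\<forall>y\<in>A. x \<le> y) \<and> (\<exists>y\<in>B. y < x)"
  then obtain x y where x: "A \<inter> B = {x}" "\<forall>y\<in>A. x \<le> y" and y: "y \<in> B" "y < x"
    by blast
  have "closed_rows A \<inter> B \<subseteq> A \<inter> B" "x \<notin> closed_rows A"
    using x by (auto simp: closed_rows_def not_less)
  moreover have "x \<in> closed_rows B \<inter> A"
    using x y by (auto simp: closed_rows_def)
  ultimately show "only_before A B"
    using x(1) by (auto simp: only_before_def)
qed

text \<open>
  The exchange keeps the shared row \<open>x\<close> and everything below it, up to the order of the two sets:
  \<open>x\<close> is below \<open>h\<close> because it belongs to \<open>A\<close>.
\<close>

lemma only_before_swap_below:
  assumes A: "A \<subseteq> {..<h}" and CD: "swap_below h (A, B) = (C, D)"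
  shows "only_before D C \<longleftrightarrow> only_before A B"
    and "only_before C D \<longleftrightarrow> only_before B A"
proof -
  have C: "C = B \<inter> {..<h}" and D: "D = A \<union> (B - {..<h})"
    using CD A by (auto simp: swap_below_def)
  have shared: "D \<inter> C = A \<inter> B"
    using A by (auto simp: C D)
  have low: "y \<in> C \<longleftrightarrow> y \<in> B" "y \<in> D \<longleftrightarrow> y \<in> A" if "y < h" for y
    using that by (auto simp: C D)
  have same: "(\<forall>y\<in>D. x \<le> y) \<longleftrightarrow> (\<forall>y\<in>A. x \<le> y)" "(\<exists>y\<in>C. y < x) \<longleftrightarrow> (\<exists>y\<in>B. y < x)"
      "(\<forall>y\<in>C. x \<le> y) \<longleftrightarrow> (\<forall>y\<in>B. x \<le> y)" "(\<exists>y\<in>D. y < x) \<longleftrightarrow> (\<exists>y\<in>A. y < x)"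
    if "x < h" for x
    using that low by (meson leI less_le_not_le less_trans)+
  have less: "x < h" if "A \<inter> B = {x}" for x
    using that A by auto
  show "only_before D C \<longleftrightarrow> only_before A B" "only_before C D \<longleftrightarrow> only_before B A"
    using same less unfolding only_before_iff
    by (simp_all add: shared Int_commute[of C] Int_commute[of B] cong: conj_cong)
qed

text \<open>
  The lowest row of \<open>A\<close> is closed by \<open>B\<close>, so in both pairs every row in use is closed, except the
  lowest row of \<open>B\<close>, which is below \<open>h\<close>.
\<close>

lemma closed_rows_swap_below:
  assumes A: "A \<subseteq> {..<h}" and CD: "swap_below h (A, B) = (C, D)"
    and AB: "only_before A B"
  shows "closed_rows C \<union> closed_rows D = closed_rows A \<union> closed_rows B"
proof -
  have closed_Un: "closed_rows X \<union> closed_rows Y = X \<union> closed_rows Y"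
    if XY: "only_before X Y" for X Y
  proof -
    obtain x where x: "X \<inter> Y = {x}" "\<forall>y\<in>X. x \<le> y" "\<exists>y\<in>Y. y < x"
      using XY unfolding only_before_iff by blast
    have "z \<in> closed_rows X" if "z \<in> X" "z \<noteq> x" for z
      using that x(1,2) le_neq_implies_less unfolding closed_rows_def by blast
    moreover have "x \<in> closed_rows Y"
      using x(1,3) by (auto simp: closed_rows_def)
    moreover have "closed_rows X \<subseteq> X"
      by (auto simp: closed_rows_def)
    ultimately show ?thesis
      by blast
  qed
  obtain y where y: "y \<in> B" "y < h"
  proof -
    obtain x y where "A \<inter> B = {x}" "y \<in> B" "y < x"
      using AB unfolding only_before_iff by blast
    moreover from this A have "x < h"
      by blast
    ultimately show thesis
      using that less_trans by blast
  qed
  have "B - {..<h} \<subseteq> closed_rows B"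
    using y by (auto simp: closed_rows_def intro!: bexI[of _ y])
  moreover have "closed_rows (B \<inter> {..<h}) = closed_rows B \<inter> {..<h}" "closed_rows B \<subseteq> B"
    by (auto simp: closed_rows_def)
  moreover have "C = B \<inter> {..<h}" "D = A \<union> (B - {..<h})"
    using CD A by (auto simp: swap_below_def)
  ultimately have "D \<union> closed_rows C = A \<union> closed_rows B"
    by blast
  moreover have "only_before D C"
    using AB only_before_swap_below(1)[OF A CD] by blast
  ultimately have "closed_rows D \<union> closed_rows C = closed_rows A \<union> closed_rows B"
    by (simp only: closed_Un AB)
  then show ?thesis
    by (simp only: Un_commute)
qed

lemma add_column_commute_le:
  assumes "h \<le> k"
  shows "add_column h (add_column k F) U = add_column k (add_column h F) U"
proof -
  define w where "w = (\<lambda>(A, B). F (U - (closed_rows A \<union> closed_rows B)))"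
  define P where "P = column_pairs U h k"
  define Q where "Q = prod.swap ` column_pairs U k h"
  have P_iff: "(A, B) \<in> P \<longleftrightarrow>
      A \<subseteq> U \<inter> {..<h} \<and> B \<subseteq> U \<inter> {..<k} \<and> closed_rows A \<inter> B = {}" for A B
    by (simp add: P_def column_pairs_def)
  have Q_iff: "(A, B) \<in> Q \<longleftrightarrow>
      A \<subseteq> U \<inter> {..<h} \<and> B \<subseteq> U \<inter> {..<k} \<and> closed_rows B \<inter> A = {}" for A B
    by (auto simp: Q_def column_pairs_def image_iff)
  have fin: "finite P" "finite Q"
    by (simp_all add: P_def Q_def finite_column_pairs)
  have bounds: "C \<subseteq> U \<inter> {..<h}" "D \<subseteq> U \<inter> {..<k}"
    if "A \<subseteq> U \<inter> {..<h}" "B \<subseteq> U \<inter> {..<k}" "swap_below h (A, B) = (C, D)" for A B C D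
    using that assms by (auto simp: swap_below_def)
  have PQ_iff: "(A, B) \<in> P - Q \<longleftrightarrow>
      A \<subseteq> U \<inter> {..<h} \<and> B \<subseteq> U \<inter> {..<k} \<and> only_before A B"
    and QP_iff: "(A, B) \<in> Q - P \<longleftrightarrow>
      A \<subseteq> U \<inter> {..<h} \<and> B \<subseteq> U \<inter> {..<k} \<and> only_before B A" for A B
    by (auto simp: P_iff Q_iff only_before_def)
  have swap: "swap_below h (swap_below h x) = x"
      "swap_below h x \<in> Q - P \<longleftrightarrow> x \<in> P - Q" "swap_below h x \<in> P - Q \<longleftrightarrow> x \<in> Q - P"
      "x \<in> P - Q \<Longrightarrow> w (swap_below h x) = w x"
    if "x \<in> P \<union> Q" for x
  proof -
    obtain A B C D where eq: "x = (A, B)" "swap_below h (A, B) = (C, D)"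
      by (metis surj_pair)
    have AB: "A \<subseteq> U \<inter> {..<h}" "B \<subseteq> U \<inter> {..<k}"
      using that by (auto simp: eq P_iff Q_iff)
    then have CD: "C \<subseteq> U \<inter> {..<h}" "D \<subseteq> U \<inter> {..<k}"
      using eq(2) assms by (auto simp: swap_below_def)
    have A: "A \<subseteq> {..<h}"
      using AB by blast
    note swap_AB = only_before_swap_below[OF A eq(2)]
    show "swap_below h (swap_below h x) = x"
      unfolding eq(1) by (rule swap_below_swap_below[OF A])
    show "swap_below h x \<in> Q - P \<longleftrightarrow> x \<in> P - Q" "swap_below h x \<in> P - Q \<longleftrightarrow> x \<in> Q - P"
      unfolding eq PQ_iff QP_iff using AB CD swap_AB by simp_all
    show "w (swap_below h x) = w x" if "x \<in> P - Q"
      using that closed_rows_swap_below[OF A eq(2)] unfolding eq PQ_iff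
      by (simp add: w_def)
  qed
  \<comment> \<open>Pairs compatible in both orders occur in both sums; the exchange matches the others.\<close>
  have "sum w (P - Q) = sum w (Q - P)"
    by (rule sum.reindex_bij_witness[where i = "swap_below h" and j = "swap_below h"])
      (use swap in blast)+
  then have "sum w P = sum w Q"
    using sum.Int_Diff[OF fin(1), of w Q] sum.Int_Diff[OF fin(2), of w P]
    by (simp add: Int_commute)
  also have "sum w Q = (\<Sum>x\<in>column_pairs U k h. w (prod.swap x))"
    by (simp add: Q_def sum.reindex)
  finally show ?thesis
    by (simp add: add_column_twice P_def w_def case_prod_unfold Un_commute)
qed

lemma add_column_commute:
  "add_column h \<circ> add_column k = add_column k \<circ> add_column h"
proof -
  have "add_column h (add_column k F) U = add_column k (add_column h F) U" for F U
    using add_column_commute_le[of h k F U] add_column_commute_le[of k h F U] by linarith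
  then show ?thesis
    by (simp add: fun_eq_iff)
qed

section \<open>Fillings as sequences of columns\<close>

fun contents :: "nat set \<Rightarrow> nat list \<Rightarrow> nat set list set" where
  "contents U [] = {[]}"
| "contents U (h # hs) =
     (\<Union>A\<in>Pow (U \<inter> {..<h}). (#) A ` contents (U - closed_rows A) hs)"

lemma finite_contents: "finite (contents U hs)"
  by (induction hs arbitrary: U) auto

lemma card_contents: "card (contents U hs) = foldr add_column hs (\<lambda>_. 1) U"
proof (induction hs arbitrary: U)
  case (Cons h hs)
  have "card (contents U (h # hs)) =
      (\<Sum>A\<in>Pow (U \<inter> {..<h}). card ((#) A ` contents (U - closed_rows A) hs))"
    unfolding contents.simps by (rule card_UN_disjoint) (auto simp: finite_contents)
  also have "\<dots> = add_column h (foldr add_column hs (\<lambda>_. 1)) U"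
    by (simp add: add_column_def[of h] card_image Cons.IH)
  finally show ?case
    by simp
qed simp

lemma card_contents_permuted:
  assumes "mset hs = mset ks"
  shows "card (contents U hs) = card (contents U ks)"
proof -
  have "fold add_column (rev hs) = fold add_column (rev ks)"
    using assms by (intro fold_multiset_equiv) (simp_all add: add_column_commute)
  then show ?thesis
    by (simp add: card_contents foldr_conv_fold)
qed

lemma contents_iff:
  "L \<in> contents U hs \<longleftrightarrow> length L = length hs \<and>
     (\<forall>j<length hs. L ! j \<subseteq> U \<inter> {..<hs ! j}) \<and>
     sorted_wrt (\<lambda>A B. closed_rows A \<inter> B = {}) L"
proof (induction hs arbitrary: L U)
  case (Cons h hs)
  show ?case
  proof (cases L)
    case L: (Cons A M)
    have open_iff: "X \<subseteq> (U - Y) \<inter> K \<longleftrightarrow> X \<subseteq> U \<inter> K \<and> Y \<inter> X = {}" for X Y K :: "nat set"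
      by blast
    have "L \<in> contents U (h # hs) \<longleftrightarrow>
        A \<subseteq> U \<inter> {..<h} \<and> M \<in> contents (U - closed_rows A) hs"
      by (auto simp: L)
    also have "\<dots> \<longleftrightarrow> A \<subseteq> U \<inter> {..<h} \<and> length M = length hs \<and>
        (\<forall>j<length hs. M ! j \<subseteq> U \<inter> {..<hs ! j}) \<and>
        (\<forall>j<length M. closed_rows A \<inter> M ! j = {}) \<and>
        sorted_wrt (\<lambda>A B. closed_rows A \<inter> B = {}) M"
      unfolding Cons.IH open_iff by metis
    also have "(\<forall>j<length M. closed_rows A \<inter> M ! j = {}) \<longleftrightarrow>
        (\<forall>B\<in>set M. closed_rows A \<inter> B = {})"
      by (auto simp: all_set_conv_all_nth)
    finally show ?thesis
      by (simp add: L All_less_Suc2 conj_ac del: contents.simps)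
  qed auto
qed auto

definition bottom_justified :: "nat list \<Rightarrow> cell set" where
  "bottom_justified hs = {(i, j). j < length hs \<and> i < hs ! j}"

text \<open>
  Columns \<open>c < c'\<close> whose contents are incompatible give a \<open>\<Gamma>\<close>: a row that \<open>c\<close> closes and \<open>c'\<close> uses
  holds its upper two ones, and the lower 1 in \<open>c\<close> that closes the row is the third.
\<close>

lemma card_gamma_free_fillings_bottom_justified:
  "card (gamma_free_fillings (bottom_justified hs)) = card (contents UNIV hs)"
proof -
  define S where "S = bottom_justified hs"
  define to_list :: "(cell \<Rightarrow> nat) \<Rightarrow> nat set list" where
    "to_list f = map (\<lambda>j. {i. i < hs ! j \<and> f (i, j) = 1}) [0..<length hs]" for f
  define of_list :: "nat set list \<Rightarrow> cell \<Rightarrow> nat" where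
    "of_list L = restrict (\<lambda>(i, j). of_bool (i \<in> L ! j)) S" for L
  have S: "(i, j) \<in> S \<longleftrightarrow> j < length hs \<and> i < hs ! j" for i j
    by (simp add: S_def bottom_justified_def)
  have free: "gamma_free S f \<longleftrightarrow> sorted_wrt (\<lambda>A B. closed_rows A \<inter> B = {}) (to_list f)" for f
  proof
    assume *: "gamma_free S f"
    show "sorted_wrt (\<lambda>A B. closed_rows A \<inter> B = {}) (to_list f)"
      unfolding sorted_wrt_iff_nth_less
    proof (intro allI impI)
      fix c c'
      assume "c < c'" "c' < length (to_list f)"
      then show "closed_rows (to_list f ! c) \<inter> to_list f ! c' = {}"
        using * unfolding gamma_free_def to_list_def closed_rows_def S by fastforce
    qed
  next
    assume *: "sorted_wrt (\<lambda>A B. closed_rows A \<inter> B = {}) (to_list f)"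
    show "gamma_free S f"
      unfolding gamma_free_def
    proof (intro notI, elim exE conjE)
      fix r r' c c'
      assume r: "r' < r" "c < c'" "(r, c) \<in> S" "(r, c') \<in> S" "(r', c) \<in> S"
        "f (r, c) = 1" "f (r, c') = 1" "f (r', c) = 1"
      then have "closed_rows (to_list f ! c) \<inter> to_list f ! c' = {}"
        using * by (auto simp: sorted_wrt_iff_nth_less to_list_def S)
      moreover have "r \<in> to_list f ! c" "r' \<in> to_list f ! c" "r \<in> to_list f ! c'"
        using r by (auto simp: to_list_def S)
      ultimately show False
        using r(1) by (auto simp: closed_rows_def)
    qed
  qed
  have of_to: "of_list (to_list f) = f" if "f \<in> fillings S" for f
  proof
    fix x :: cell
    show "of_list (to_list f) x = f x"
    proof (cases "x \<in> S")
      case True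
      then have "f x \<in> {0, 1}"
        using that by (auto simp: fillings_def)
      with True show ?thesis
        by (cases x) (auto simp: of_list_def to_list_def S)
    next
      case False
      then show ?thesis
        using that PiE_arb[of f S "\<lambda>_. {0, 1}" x]
        by (simp add: of_list_def fillings_def)
    qed
  qed
  have to_of: "to_list (of_list L) = L"
    if L: "length L = length hs" "\<forall>j<length hs. L ! j \<subseteq> {..<hs ! j}" for L
  proof (rule nth_equalityI)
    show "length (to_list (of_list L)) = length L"
      using L by (simp add: to_list_def)
    fix j
    assume "j < length (to_list (of_list L))"
    then have "j < length hs" "L ! j \<subseteq> {..<hs ! j}"
      using L(2) by (auto simp: to_list_def)
    then show "to_list (of_list L) ! j = L ! j"
      by (auto simp: to_list_def of_list_def S)
  qed
  have "bij_betw to_list (gamma_free_fillings S) (contents UNIV hs)"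
  proof (rule bij_betw_byWitness[where f' = of_list])
    show "\<forall>f\<in>gamma_free_fillings S. of_list (to_list f) = f"
      by (simp add: gamma_free_fillings_def of_to)
    show "\<forall>L\<in>contents UNIV hs. to_list (of_list L) = L"
      by (simp add: contents_iff to_of)
    show "to_list ` gamma_free_fillings S \<subseteq> contents UNIV hs"
      using free by (auto simp: gamma_free_fillings_def contents_iff to_list_def)
    have "of_list L \<in> fillings S" for L
      by (auto simp: fillings_def of_list_def)
    then show "of_list ` contents UNIV hs \<subseteq> gamma_free_fillings S"
      by (auto simp: gamma_free_fillings_def contents_iff free to_of)
  qed
  then show ?thesis
    unfolding S_def by (rule bij_betw_same_card)
qed

section \<open>Permuting the columns of a Ferrers shape\<close>

lemma sorted_wrt_ge_nth_mono:
  assumes "sorted_wrt (\<ge>) lam" "i \<le> j" "j < length lam"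
  shows "(lam ! j :: nat) \<le> lam ! i"
  using assms by (cases "i = j") (auto simp: sorted_wrt_iff_nth_less)

text \<open>
  The heights are the parts of the conjugate partition. None of them is zero, so the nonempty columns
  are indexed by the positions of the list, and permuting them permutes the list.
\<close>

lemma ferrers_shape_bottom_justified:
  assumes "is_partition lam"
  obtains hs where "ferrers_shape lam = bottom_justified hs"
    and "columns (ferrers_shape lam) = {..<length hs}"
proof -
  define n where "n = (if lam = [] then 0 else lam ! 0)"
  define height where "height j = card {i. i < length lam \<and> j < lam ! i}" for j
  have down: "i' < length lam \<and> j < lam ! i'"
    if "i < length lam" "j < lam ! i" "i' \<le> i" for i i' j
    using that assms sorted_wrt_ge_nth_mono[of lam i' i] by (auto simp: is_partition_def)
  have height: "i < height j \<longleftrightarrow> i < length lam \<and> j < lam ! i" for i j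
  proof
    assume "i < height j"
    show "i < length lam \<and> j < lam ! i"
    proof (rule ccontr)
      assume "\<not> ?thesis"
      then have "{i. i < length lam \<and> j < lam ! i} \<subseteq> {..<i}"
        using down by (metis (mono_tags, lifting) lessThan_iff linorder_not_less mem_Collect_eq subsetI)
      then have "height j \<le> i"
        unfolding height_def using card_mono[of "{..<i}"] by simp
      with \<open>i < height j\<close> show False
        by simp
    qed
  next
    assume "i < length lam \<and> j < lam ! i"
    then have "{..i} \<subseteq> {i. i < length lam \<and> j < lam ! i}"
      using down by blast
    then have "card {..i} \<le> height j"
      unfolding height_def by (intro card_mono) auto
    then show "i < height j"
      by simp
  qed
  have n: "j < n \<longleftrightarrow> (\<exists>i<length lam. j < lam ! i)" for j
    proof
    assume "j < n"
    then show "\<exists>i<length lam. j < lam ! i"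
      by (auto simp: n_def split: if_splits)
  next
    assume "\<exists>i<length lam. j < lam ! i"
    then have "0 < length lam \<and> j < lam ! 0"
      using down by blast
    then show "j < n"
      by (simp add: n_def)
  qed
  show thesis
  proof
    have "(i, j) \<in> ferrers_shape lam \<longleftrightarrow> (i, j) \<in> bottom_justified (map height [0..<n])" for i j
      using n[of j] by (cases "j < n") (auto simp: ferrers_shape_def bottom_justified_def height)
    then show "ferrers_shape lam = bottom_justified (map height [0..<n])"
      by auto
    show "columns (ferrers_shape lam) = {..<length (map height [0..<n])}"
      by (auto simp: columns_def ferrers_shape_def image_iff n)
  qed
qed

theorem theorem27:
  fixes lam :: "nat list" and T :: "cell set"
  assumes "is_partition lam"
    and "column_permuted (ferrers_shape lam) T"
  shows "card (gamma_free_fillings T) = card (gamma_free_fillings (ferrers_shape lam))"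
proof -
  obtain hs where hs: "ferrers_shape lam = bottom_justified hs"
      "columns (ferrers_shape lam) = {..<length hs}"
    using ferrers_shape_bottom_justified[OF assms(1)] .
  obtain p where p: "p permutes {..<length hs}"
    and T: "T = (\<lambda>(i, j). (i, p j)) ` bottom_justified hs"
    using assms(2) unfolding column_permuted_def hs(2) unfolding hs(1) by blast
  define ks where "ks = permute_list (inv p) hs"
  have inv: "inv p permutes {..<length hs}"
    using p by (rule permutes_inv)
  have "T = bottom_justified ks"
  proof (rule set_eqI, clarify)
    fix i j
    have "(i, j) \<in> T \<longleftrightarrow> (i, inv p j) \<in> bottom_justified hs"
      unfolding T image_iff using permutes_inverses[OF p] by (metis (no_types, lifting) case_prod_conv prod.inject surj_pair)
    also have "\<dots> \<longleftrightarrow> (i, j) \<in> bottom_justified ks"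
      using permutes_in_image[OF inv, of j] inv
      by (auto simp: bottom_justified_def ks_def permute_list_nth)
    finally show "(i, j) \<in> T \<longleftrightarrow> (i, j) \<in> bottom_justified ks" .
  qed
  moreover have "mset ks = mset hs"
    using inv by (simp add: ks_def)
  ultimately show ?thesis
    using card_contents_permuted[of ks hs UNIV]
    by (simp add: hs card_gamma_free_fillings_bottom_justified)
qed

end
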